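(* For $n\ge 1$, let $\mathcal{R}_n\subseteq\mathcal{S}^n$ be the set of matrices $M=(m_{i,j})$ satisfying the following two conditions: (I) For every off-diagonal entry $m_{i,j}>0$ ($i\ne j$): $m_{i,j}\le m_{i+1,j}$ whenever $i+1\le n$ and $i+1\neq j$, and $m_{i,j}\le m_{i,j+1}$ whenever $j+1\le n$ and $j+1\neq i$. (II) If $k=\mathrm{idx}(M)$, then $m_{i,j}\le m_{i,j+1}$ for all $i\in\{1,\dots,n-1\}$ and all $j$ with $\max\{k,i+1\}\le j\le n-1$. Then $\mathcal{R}_n\cap\mathcal{C}op_n=\mathcal{R}_n\cap\mathcal{SPN}_n$.
   Context: $\mathcal{S}^n$ is the set of real symmetric $n\times n$ matrices. $\mathcal{C}op_n\subseteq\mathcal{S}^n$ is the cone of copositive matrices ($x^\top A x\ge0$ for all entrywise nonnegative $x\in\mathbb{R}^n$). $\mathcal{SPN}_n\subseteq\mathcal{S}^n$ is the cone of matrices that are the sum of a symmetric positive semidefinite matrix and a symmetric entrywise nonnegative matrix. The positive index of $M\in\mathcal{S}^n$ is $\mathrm{idx}(M)=\min\{i : m_{i,j}>0 \text{ for some } j\in\{1,\dots,n\},\ j\neq i\}$, the first row with a positive off-diagonal entry; if all off-diagonal entries of $M$ are nonpositive, then $\mathrm{idx}(M)=n+1$. *)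

theory Defs
  imports "Jordan_Normal_Form.Matrix" Complex_Main
begin

text \<open>
  Rows and columns are indexed by 0, ..., n-1 instead of 1, ..., n.
  The orders on vectors and matrices are the entrywise ones of
  \<^theory>\<open>Jordan_Normal_Form.Matrix\<close>.
\<close>

definition sym_mats :: "nat \<Rightarrow> real mat set" where
  "sym_mats n = {A \<in> carrier_mat n n. transpose_mat A = A}"

definition copositive_mats :: "nat \<Rightarrow> real mat set" where
  "copositive_mats n =
     {A \<in> sym_mats n. \<forall>x \<in> carrier_vec n. 0\<^sub>v n \<le> x \<longrightarrow> 0 \<le> x \<bullet> (A *\<^sub>v x)}"

definition psd_mats :: "nat \<Rightarrow> real mat set" where
  "psd_mats n = {A \<in> sym_mats n. \<forall>x \<in> carrier_vec n. 0 \<le> x \<bullet> (A *\<^sub>v x)}"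

definition nonneg_sym_mats :: "nat \<Rightarrow> real mat set" where
  "nonneg_sym_mats n = {A \<in> sym_mats n. 0\<^sub>m n n \<le> A}"

definition spn_mats :: "nat \<Rightarrow> real mat set" where
  "spn_mats n = {P + N | P N. P \<in> psd_mats n \<and> N \<in> nonneg_sym_mats n}"

definition pos_rows :: "real mat \<Rightarrow> nat set" where
  "pos_rows M = {i. i < dim_row M \<and> (\<exists>j < dim_col M. j \<noteq> i \<and> M $$ (i, j) > 0)}"

text \<open>
  With indices starting at 0, the index of an n-by-n matrix without positive
  off-diagonal entries is n, corresponding to n+1 in the 1-based convention.
\<close>

definition pos_idx :: "real mat \<Rightarrow> nat" where
  "pos_idx M = (if pos_rows M = {} then dim_row M else Min (pos_rows M))"

definition cond_I :: "nat \<Rightarrow> real mat \<Rightarrow> bool" where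
  "cond_I n M \<longleftrightarrow>
     (\<forall>i < n. \<forall>j < n. i \<noteq> j \<longrightarrow> M $$ (i, j) > 0 \<longrightarrow>
        (i + 1 < n \<longrightarrow> i + 1 \<noteq> j \<longrightarrow> M $$ (i, j) \<le> M $$ (i + 1, j)) \<and>
        (j + 1 < n \<longrightarrow> j + 1 \<noteq> i \<longrightarrow> M $$ (i, j) \<le> M $$ (i, j + 1)))"

text \<open>
  The 1-based ranges i = 1, ..., n-1 and max(k, i+1) \<open>\<le>\<close> j \<open>\<le>\<close> n-1 keep their
  lower bound max(k, i+1) under the shift, since i, j and k all decrease by one.
\<close>

definition cond_II :: "nat \<Rightarrow> real mat \<Rightarrow> bool" where
  "cond_II n M \<longleftrightarrow>
     (\<forall>i j. i + 1 < n \<longrightarrow> max (pos_idx M) (i + 1) \<le> j \<longrightarrow> j + 1 < n \<longrightarrow>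
        M $$ (i, j) \<le> M $$ (i, j + 1))"

definition R_mats :: "nat \<Rightarrow> real mat set" where
  "R_mats n = {M \<in> sym_mats n. cond_I n M \<and> cond_II n M}"

end

theory Submission
  imports Defs
begin

text \<open>
  The sum of a positive semidefinite and a nonnegative matrix is always copositive. For the converse,
  shrink the index set from both ends while keeping the row numbering; the current index set is
  \<open>{a..<b}\<close> and the current matrix is \<open>m\<close>.

  If every off-diagonal entry of the first row \<open>a\<close> is nonpositive, then the quadratic form, restricted
  to nonnegative vectors, is minimised in the coordinate \<open>a\<close> at a nonnegative point. So the Schur
  complement of \<open>m a a\<close> is again copositive, and \<open>m\<close> differs from it by a positive semidefinite
  matrix of rank at most one (\<open>schur_copositive\<close>, \<open>schur_spn\<close>). If \<open>m a a = 0\<close>, copositivity makes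
  the whole row \<open>a\<close> vanish, and it can simply be removed. The Schur complement subtracts the products \<open>m a i * m a j / m a a\<close>. These are nonnegative, so no new positive
  off-diagonal entry arises; and they are nonincreasing in \<open>i\<close> and in \<open>j\<close> from the column \<open>k\<close> on, by
  the monotonicity of row \<open>a\<close>, so both monotonicity conditions persist (\<open>monotone_pattern_schur\<close>).

  Otherwise the first row has a positive off-diagonal entry, and monotonicity along the row and then
  down the last column makes all off-diagonal entries of the last column positive. They may be
  replaced by zero, which leaves a smaller principal submatrix and a nonnegative diagonal entry
  (\<open>monotone_pattern_last_column_pos\<close>, \<open>spn_drop_nonneg_column\<close>).
\<close>

section \<open>Quadratic forms on finite index sets\<close>

definition quad_form :: "'i set \<Rightarrow> ('i \<Rightarrow> 'i \<Rightarrow> real) \<Rightarrow> ('i \<Rightarrow> real) \<Rightarrow> real" where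
  "quad_form S m x = (\<Sum>i\<in>S. \<Sum>j\<in>S. x i * m i j * x j)"

text \<open>
  Requiring \<open>x\<close> to be nonnegative everywhere loses nothing, since values outside \<open>S\<close> do not enter
  the form.
\<close>

definition copositive_on :: "'i set \<Rightarrow> ('i \<Rightarrow> 'i \<Rightarrow> real) \<Rightarrow> bool" where
  "copositive_on S m \<longleftrightarrow> (\<forall>x. (\<forall>i. 0 \<le> x i) \<longrightarrow> 0 \<le> quad_form S m x)"

definition symmetric_on :: "'i set \<Rightarrow> ('i \<Rightarrow> 'i \<Rightarrow> real) \<Rightarrow> bool" where
  "symmetric_on S m \<longleftrightarrow> (\<forall>i\<in>S. \<forall>j\<in>S. m i j = m j i)"

text \<open>
  Being a sum of a positive semidefinite and a nonnegative matrix is encoded by the positive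
  semidefinite summand \<open>P\<close> alone: the nonnegative summand is \<open>m - P\<close>.
\<close>

definition spn_on :: "'i set \<Rightarrow> ('i \<Rightarrow> 'i \<Rightarrow> real) \<Rightarrow> bool" where
  "spn_on S m \<longleftrightarrow> (\<exists>P. symmetric_on S P \<and> (\<forall>x. 0 \<le> quad_form S P x) \<and>
                        (\<forall>i\<in>S. \<forall>j\<in>S. P i j \<le> m i j))"

lemma symmetric_onD: "symmetric_on S m \<Longrightarrow> i \<in> S \<Longrightarrow> j \<in> S \<Longrightarrow> m i j = m j i"
  by (simp add: symmetric_on_def)

lemma symmetric_on_subset: "symmetric_on S m \<Longrightarrow> T \<subseteq> S \<Longrightarrow> symmetric_on T m"
  by (auto simp: symmetric_on_def)

lemma quad_form_cong:
  assumes "\<And>i j. i \<in> S \<Longrightarrow> j \<in> S \<Longrightarrow> m i j = m' i j"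
    and "\<And>i. i \<in> S \<Longrightarrow> x i = y i"
  shows "quad_form S m x = quad_form S m' y"
  unfolding quad_form_def by (intro sum.cong refl) (simp add: assms)

lemma quad_form_add: "quad_form S (\<lambda>i j. p i j + q i j) x = quad_form S p x + quad_form S q x"
  by (simp add: quad_form_def algebra_simps sum.distrib)

lemma quad_form_rank_one:
  "quad_form S (\<lambda>i j. b i * b j / d) x = (\<Sum>i\<in>S. b i * x i)\<^sup>2 / d"
  unfolding quad_form_def power2_eq_square sum_product sum_divide_distrib
  by (intro sum.cong refl) (simp add: field_simps)

lemma quad_form_restrict:
  assumes "finite S" "T \<subseteq> S"
  shows "quad_form S (\<lambda>i j. if i \<in> T \<and> j \<in> T then m i j else 0) x = quad_form T m x"
proof -
  have inner: "(\<Sum>j\<in>S. x i * (if i \<in> T \<and> j \<in> T then m i j else 0) * x j)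
      = (if i \<in> T then \<Sum>j\<in>T. x i * m i j * x j else 0)" for i
  proof (cases "i \<in> T")
    case True
    have "(\<Sum>j\<in>T. x i * m i j * x j)
        = (\<Sum>j\<in>S. x i * (if i \<in> T \<and> j \<in> T then m i j else 0) * x j)"
      by (rule sum.mono_neutral_cong_left) (use assms True in auto)
    with True show ?thesis by simp
  qed simp
  have "(\<Sum>i\<in>T. \<Sum>j\<in>T. x i * m i j * x j)
      = (\<Sum>i\<in>S. if i \<in> T then \<Sum>j\<in>T. x i * m i j * x j else 0)"
    by (rule sum.mono_neutral_cong_left) (use assms in auto)
  then show ?thesis
    unfolding quad_form_def inner by simp
qed

lemma copositive_on_subset:
  assumes "copositive_on S m" "finite S" "T \<subseteq> S"
  shows "copositive_on T m"
  unfolding copositive_on_def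
proof (intro allI impI)
  fix x :: "'a \<Rightarrow> real"
  assume x: "\<forall>i. 0 \<le> x i"
  let ?y = "\<lambda>i. if i \<in> T then x i else 0"
  have "0 \<le> quad_form S m ?y"
    using assms(1) x by (simp add: copositive_on_def)
  also have "quad_form S m ?y
      = quad_form S (\<lambda>i j. if i \<in> T \<and> j \<in> T then m i j else 0) x"
    unfolding quad_form_def by (intro sum.cong refl) auto
  also have "\<dots> = quad_form T m x"
    using assms(2,3) by (rule quad_form_restrict)
  finally show "0 \<le> quad_form T m x" .
qed

lemma copositive_on_diag_nonneg:
  assumes "copositive_on S m" "finite S" "a \<in> S"
  shows "0 \<le> m a a"
proof -
  have "copositive_on {a} m"
    using assms by (auto intro: copositive_on_subset[OF assms(1)])
  then have "0 \<le> quad_form {a} m (\<lambda>_. 1)"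
    unfolding copositive_on_def by simp
  then show ?thesis by (simp add: quad_form_def)
qed

lemma copositive_on_zero_diag:
  assumes "copositive_on S m" "symmetric_on S m" "finite S" "a \<in> S" "j \<in> S" "a \<noteq> j"
    and diag: "m a a = 0"
  shows "0 \<le> m a j"
proof (rule ccontr)
  assume "\<not> 0 \<le> m a j"
  then have neg: "m a j < 0" by simp
  \<comment> \<open>The value of \<open>t\<close> solves \<open>2 * t * m a j + m j j = -1\<close>.\<close>
  define t where "t = (m j j + 1) / (- 2 * m a j)"
  have "0 \<le> m j j"
    using assms by (intro copositive_on_diag_nonneg[of S]) auto
  with neg have t: "0 \<le> t" by (simp add: t_def divide_nonneg_neg)
  have "copositive_on {a, j} m"
    using assms by (auto intro: copositive_on_subset[OF assms(1)])
  then have "0 \<le> quad_form {a, j} m (\<lambda>i. if i = a then t else 1)"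
    unfolding copositive_on_def using t by simp
  also have "\<dots> = 2 * t * m a j + m j j"
    using assms(6) diag symmetric_onD[OF assms(2,5,4)] by (simp add: quad_form_def)
  also have "\<dots> = -1"
    using neg by (simp add: t_def field_simps)
  finally show False by simp
qed

section \<open>Eliminating a row without positive off-diagonal entries\<close>

text \<open>
  The Schur complement of the diagonal entry at \<open>a\<close>; only its entries outside row and column \<open>a\<close>
  matter. If \<open>m a a = 0\<close>, the quotient is zero by convention and the submatrix is unchanged, which is
  appropriate because the whole row \<open>a\<close> vanishes in that case.
\<close>

definition schur :: "'i \<Rightarrow> ('i \<Rightarrow> 'i \<Rightarrow> real) \<Rightarrow> 'i \<Rightarrow> 'i \<Rightarrow> real" where
  "schur a m i j = m i j - m a i * m a j / m a a"

lemma symmetric_on_schur: "symmetric_on S m \<Longrightarrow> symmetric_on S (schur a m)"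
  by (simp add: symmetric_on_def schur_def mult.commute)

lemma schur_decomposition:
  assumes "symmetric_on S m" "a \<in> S" "i \<in> S" "j \<in> S"
    and null: "\<And>j. j \<in> S \<Longrightarrow> m a a = 0 \<Longrightarrow> m a j = 0"
  shows "m i j = (if i \<in> S - {a} \<and> j \<in> S - {a} then schur a m i j else 0)
                 + m a i * m a j / m a a"
proof (cases "m a a = 0")
  case True
  then show ?thesis
    using null[of i] null[of j] assms symmetric_onD[OF assms(1), of a i]
    by (auto simp: schur_def)
next
  case False
  then show ?thesis
    using assms symmetric_onD[OF assms(1), of a i] by (auto simp: schur_def)
qed

lemma quad_form_rank_one_update:
  assumes "finite S"
  shows "quad_form S (\<lambda>i j. (if i \<in> S - {a} \<and> j \<in> S - {a} then p i j else 0) + b i * b j / d) x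
       = quad_form (S - {a}) p x + (\<Sum>i\<in>S. b i * x i)\<^sup>2 / d"
  unfolding quad_form_add quad_form_rank_one
  using quad_form_restrict[of S "S - {a}" p x] assms by auto

lemma copositive_on_nonpos_row_null:
  assumes "copositive_on S m" "symmetric_on S m" "finite S" "a \<in> S"
    and "\<And>j. j \<in> S \<Longrightarrow> j \<noteq> a \<Longrightarrow> m a j \<le> 0"
    and "j \<in> S" "m a a = 0"
  shows "m a j = 0"
proof (cases "j = a")
  case False
  then show ?thesis
    using copositive_on_zero_diag[OF assms(1-4,6) _ assms(7)] assms(5)[OF assms(6)] by simp
qed (use assms in simp)

lemma schur_copositive:
  assumes cop: "copositive_on S m" and sym: "symmetric_on S m" and fin: "finite S" and a: "a \<in> S"
    and row: "\<And>j. j \<in> S \<Longrightarrow> j \<noteq> a \<Longrightarrow> m a j \<le> 0"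
  shows "copositive_on (S - {a}) (schur a m)"
  unfolding copositive_on_def
proof (intro allI impI)
  fix x :: "'a \<Rightarrow> real"
  assume x: "\<forall>i. 0 \<le> x i"
  note null = copositive_on_nonpos_row_null[OF cop sym fin a row]
  define r where "r = (\<Sum>j\<in>S - {a}. m a j * x j)"
  \<comment> \<open>The coordinate \<open>a\<close> is set to the minimiser of the form in that coordinate; if \<open>m a a = 0\<close>, this
     is 0 by convention, and the form does not depend on that coordinate.\<close>
  define y where "y = x(a := - r / m a a)"
  have "r \<le> 0"
    unfolding r_def using row x by (intro sum_nonpos) (simp add: mult_nonpos_nonneg)
  moreover have "0 \<le> m a a"
    using cop fin a by (rule copositive_on_diag_nonneg)
  ultimately have "0 \<le> - r / m a a"
    by (intro divide_nonneg_nonneg) auto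
  then have "\<forall>i. 0 \<le> y i"
    using x by (simp add: y_def)
  then have "0 \<le> quad_form S m y"
    using cop by (simp add: copositive_on_def)
  also have "quad_form S m y = quad_form (S - {a}) (schur a m) y + (\<Sum>i\<in>S. m a i * y i)\<^sup>2 / m a a"
    unfolding quad_form_rank_one_update[OF fin, symmetric]
    by (rule quad_form_cong, rule schur_decomposition[OF sym a _ _ null]) auto
  also have "(\<Sum>i\<in>S. m a i * y i) = m a a * y a + (\<Sum>i\<in>S - {a}. m a i * y i)"
    using fin a by (rule sum.remove)
  also have "(\<Sum>i\<in>S - {a}. m a i * y i) = r"
    unfolding r_def by (rule sum.cong) (auto simp: y_def)
  also have "(m a a * y a + r)\<^sup>2 / m a a = 0"
    by (simp add: y_def)
  also have "quad_form (S - {a}) (schur a m) y = quad_form (S - {a}) (schur a m) x"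
    by (rule quad_form_cong) (auto simp: y_def)
  finally show "0 \<le> quad_form (S - {a}) (schur a m) x" by simp
qed

lemma schur_spn:
  assumes spn: "spn_on (S - {a}) (schur a m)"
    and cop: "copositive_on S m" and sym: "symmetric_on S m" and fin: "finite S" and a: "a \<in> S"
    and row: "\<And>j. j \<in> S \<Longrightarrow> j \<noteq> a \<Longrightarrow> m a j \<le> 0"
  shows "spn_on S m"
proof -
  note null = copositive_on_nonpos_row_null[OF cop sym fin a row]
  obtain P where P: "symmetric_on (S - {a}) P" "\<And>x. 0 \<le> quad_form (S - {a}) P x"
    "\<And>i j. i \<in> S - {a} \<Longrightarrow> j \<in> S - {a} \<Longrightarrow> P i j \<le> schur a m i j"
    using spn unfolding spn_on_def by blast
  define Q where
    "Q = (\<lambda>i j. (if i \<in> S - {a} \<and> j \<in> S - {a} then P i j else 0) + m a i * m a j / m a a)"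
  have "symmetric_on S Q"
    using symmetric_onD[OF P(1)] by (auto simp: symmetric_on_def Q_def mult.commute)
  moreover have "0 \<le> quad_form S Q x" for x
    unfolding Q_def quad_form_rank_one_update[OF fin]
    using P(2) copositive_on_diag_nonneg[OF cop fin a] by simp
  moreover have "Q i j \<le> m i j" if "i \<in> S" "j \<in> S" for i j
    using P(3)[of i j] by (subst schur_decomposition[OF sym a that null]) (auto simp: Q_def)
  ultimately show ?thesis
    unfolding spn_on_def by blast
qed

section \<open>Dropping a nonnegative row and column\<close>

lemma spn_drop_nonneg_column:
  assumes spn: "spn_on (S - {c}) m" and sym: "symmetric_on S m" and fin: "finite S" and c: "c \<in> S"
    and col: "\<And>i. i \<in> S \<Longrightarrow> 0 \<le> m i c"
  shows "spn_on S m"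
proof -
  obtain P where P: "symmetric_on (S - {c}) P" "\<And>x. 0 \<le> quad_form (S - {c}) P x"
    "\<And>i j. i \<in> S - {c} \<Longrightarrow> j \<in> S - {c} \<Longrightarrow> P i j \<le> m i j"
    using spn unfolding spn_on_def by blast
  define Q where "Q = (\<lambda>i j. if i \<in> S - {c} \<and> j \<in> S - {c} then P i j else 0)"
  have "symmetric_on S Q"
    using symmetric_onD[OF P(1)] by (auto simp: symmetric_on_def Q_def)
  moreover have "0 \<le> quad_form S Q x" for x
    unfolding Q_def using quad_form_restrict[of S "S - {c}" P x] fin P(2) by auto
  moreover have "Q i j \<le> m i j" if "i \<in> S" "j \<in> S" for i j
    using P(3)[of i j] col that symmetric_onD[OF sym c that(2)] by (auto simp: Q_def)
  ultimately show ?thesis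
    unfolding spn_on_def by blast
qed

section \<open>Matrices with a monotone pattern\<close>

text \<open>
  The pattern conditions on the strict upper triangle of \<open>{a..<b}\<close>: positive entries occur only in
  rows from \<open>k\<close> on; rows are nondecreasing from column \<open>k\<close> on; positive entries do not decrease
  downwards. The number \<open>k\<close> is only required to be a lower bound for the positive index, because
  the positive index itself may grow under the reductions whereas a lower bound stays valid.
\<close>

definition monotone_pattern :: "nat \<Rightarrow> nat \<Rightarrow> nat \<Rightarrow> (nat \<Rightarrow> nat \<Rightarrow> real) \<Rightarrow> bool" where
  "monotone_pattern k a b m \<longleftrightarrow>
     (\<forall>i j. a \<le> i \<longrightarrow> i < j \<longrightarrow> j < b \<longrightarrow> 0 < m i j \<longrightarrow> k \<le> i) \<and>
     (\<forall>i j. a \<le> i \<longrightarrow> i < j \<longrightarrow> k \<le> j \<longrightarrow> j + 1 < b \<longrightarrow> m i j \<le> m i (j + 1)) \<and>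
     (\<forall>i j. a \<le> i \<longrightarrow> i + 1 < j \<longrightarrow> j < b \<longrightarrow> 0 < m i j \<longrightarrow> m i j \<le> m (i + 1) j)"

lemma monotone_patternD:
  assumes "monotone_pattern k a b m"
  shows "a \<le> i \<Longrightarrow> i < j \<Longrightarrow> j < b \<Longrightarrow> 0 < m i j \<Longrightarrow> k \<le> i"
    and "a \<le> i \<Longrightarrow> i < j \<Longrightarrow> k \<le> j \<Longrightarrow> j + 1 < b \<Longrightarrow> m i j \<le> m i (j + 1)"
    and "a \<le> i \<Longrightarrow> i + 1 < j \<Longrightarrow> j < b \<Longrightarrow> 0 < m i j \<Longrightarrow> m i j \<le> m (i + 1) j"
  using assms unfolding monotone_pattern_def by blast+

lemma monotone_pattern_schur:
  assumes pat: "monotone_pattern k a b m" and diag: "0 \<le> m a a"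
    and row: "\<And>j. a < j \<Longrightarrow> j < b \<Longrightarrow> m a j \<le> 0"
  shows "monotone_pattern k (a + 1) b (schur a m)"
proof -
  have prod_nonneg: "0 \<le> m a i * m a j / m a a" if "a < i" "i < b" "a < j" "j < b" for i j
    using row that diag by (intro divide_nonneg_nonneg mult_nonpos_nonpos) auto
  have prod_mono: "m a i * m a (j + 1) / m a a \<le> m a i * m a j / m a a"
    if "a < i" "i < b" "a < j" "k \<le> j" "j + 1 < b" for i j
    using row[of i] monotone_patternD(2)[OF pat, of a j] that diag
    by (intro divide_right_mono mult_left_mono_neg) auto
  have pos: "0 < m i j" if "a < i" "i < j" "j < b" "0 < schur a m i j" for i j
    using prod_nonneg[of i j] that by (simp add: schur_def)
  have k_le: "k \<le> i" if "a < i" "i < j" "j < b" "0 < schur a m i j" for i j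
    using monotone_patternD(1)[OF pat] pos that by simp
  have "schur a m i j \<le> schur a m i (j + 1)" if "a < i" "i < j" "k \<le> j" "j + 1 < b" for i j
    using monotone_patternD(2)[OF pat, of i j] prod_mono[of i j] that by (simp add: schur_def)
  moreover have "schur a m i j \<le> schur a m (i + 1) j"
    if "a < i" "i + 1 < j" "j < b" "0 < schur a m i j" for i j
    using monotone_patternD(3)[OF pat, of i j] prod_mono[of j i] k_le[of i j] pos[of i j] that
    by (simp add: schur_def mult.commute)
  ultimately show ?thesis
    using k_le by (simp add: monotone_pattern_def Suc_le_eq)
qed

lemma monotone_pattern_last_column_pos:
  assumes pat: "monotone_pattern k a (Suc c) m" and pos: "0 < m a j" and j: "a < j" "j \<le> c"
    and i: "a \<le> i" "i < c"
  shows "0 < m i c"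
proof -
  have k: "k \<le> a"
    using monotone_patternD(1)[OF pat] pos j by simp
  have "0 < m a l" if "j \<le> l" "l \<le> c" for l
    using that
  proof (induction l rule: dec_induct)
    case (step l)
    then show ?case
      using monotone_patternD(2)[OF pat, of a l] k j by simp
  qed (rule pos)
  then have last: "0 < m a c" using j by simp
  show ?thesis
    using i
  proof (induction i rule: dec_induct)
    case (step i)
    then show ?case
      using monotone_patternD(3)[OF pat, of i c] by simp
  qed (rule last)
qed

lemma copositive_monotone_pattern_spn:
  assumes "copositive_on {a..<b} m" "symmetric_on {a..<b} m" "monotone_pattern k a b m"
  shows "spn_on {a..<b} m"
  using assms
proof (induction "b - a" arbitrary: a b m)
  case 0
  then show ?case
    by (auto simp: spn_on_def symmetric_on_def quad_form_def)
next
  case (Suc d)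
  let ?S = "{a..<b}"
  note cop = Suc.prems(1) and sym = Suc.prems(2) and pat = Suc.prems(3)
  have ab: "a < b" and a: "a \<in> ?S" using Suc.hyps(2) by auto
  show ?case
  proof (cases "\<forall>j. a < j \<and> j < b \<longrightarrow> m a j \<le> 0")
    case True
    then have row: "m a j \<le> 0" if "j \<in> ?S" "j \<noteq> a" for j
      using that by auto
    have S: "?S - {a} = {a + 1..<b}" by auto
    have "spn_on {a + 1..<b} (schur a m)"
    proof (rule Suc.hyps(1))
      show "d = b - (a + 1)" using Suc.hyps(2) by simp
      show "copositive_on {a + 1..<b} (schur a m)"
        using schur_copositive[OF cop sym _ a row] S by simp
      show "symmetric_on {a + 1..<b} (schur a m)"
        using sym by (intro symmetric_on_schur symmetric_on_subset[OF sym]) auto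
      show "monotone_pattern k (a + 1) b (schur a m)"
        using pat copositive_on_diag_nonneg[OF cop _ a] True
        by (intro monotone_pattern_schur) auto
    qed
    then show ?thesis
      using schur_spn[OF _ cop sym _ a row] S by simp
  next
    case False
    then obtain j where j: "a < j" "j < b" "0 < m a j" by force
    define c where "c = b - 1"
    have b: "b = Suc c" and c: "c \<in> ?S" using ab by (auto simp: c_def)
    have S: "?S - {c} = {a..<c}" by (auto simp: b)
    have "spn_on {a..<c} m"
    proof (rule Suc.hyps(1))
      show "d = c - a" using Suc.hyps(2) b by simp
      show "copositive_on {a..<c} m"
        using cop by (rule copositive_on_subset) (auto simp: b)
      show "symmetric_on {a..<c} m"
        using sym by (rule symmetric_on_subset) (auto simp: b)
      show "monotone_pattern k a c m"
        using pat unfolding monotone_pattern_def b by auto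
    qed
    moreover have "0 \<le> m i c" if "i \<in> ?S" for i
    proof (cases "i = c")
      case True
      then show ?thesis using copositive_on_diag_nonneg[OF cop _ c] by simp
    next
      case False
      then show ?thesis
        using monotone_pattern_last_column_pos[OF pat[unfolded b] j(3), of i] j that b by simp
    qed
    ultimately show ?thesis
      using spn_drop_nonneg_column[OF _ sym _ c] S by simp
  qed
qed

section \<open>Transfer to matrices\<close>

lemma scalar_prod_mult_mat_vec_eq_quad_form:
  assumes "A \<in> carrier_mat n n" "x \<in> carrier_vec n"
  shows "x \<bullet> (A *\<^sub>v x) = quad_form {0..<n} (\<lambda>i j. A $$ (i, j)) (\<lambda>i. x $ i)"
  using assms unfolding scalar_prod_def quad_form_def
  by (auto simp: scalar_prod_def sum_distrib_left mult.assoc intro!: sum.cong)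

lemma sym_mats_iff:
  "A \<in> sym_mats n \<longleftrightarrow> A \<in> carrier_mat n n \<and> symmetric_on {0..<n} (\<lambda>i j. A $$ (i, j))"
  unfolding sym_mats_def symmetric_on_def
  by (auto intro!: eq_matI) (metis carrier_matD index_transpose_mat(1))

lemma copositive_mats_copositive_on:
  assumes "A \<in> copositive_mats n"
  shows "copositive_on {0..<n} (\<lambda>i j. A $$ (i, j))"
  unfolding copositive_on_def
proof (intro allI impI)
  fix x :: "nat \<Rightarrow> real"
  assume "\<forall>i. 0 \<le> x i"
  then have "0 \<le> vec n x \<bullet> (A *\<^sub>v vec n x)"
    using assms by (auto simp: copositive_mats_def less_eq_vec_def)
  also have "\<dots> = quad_form {0..<n} (\<lambda>i j. A $$ (i, j)) (\<lambda>i. vec n x $ i)"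
    using assms
    by (intro scalar_prod_mult_mat_vec_eq_quad_form) (auto simp: copositive_mats_def sym_mats_def)
  also have "\<dots> = quad_form {0..<n} (\<lambda>i j. A $$ (i, j)) x"
    by (rule quad_form_cong) auto
  finally show "0 \<le> quad_form {0..<n} (\<lambda>i j. A $$ (i, j)) x" .
qed

lemma spn_on_spn_mats:
  assumes A: "A \<in> sym_mats n" and spn: "spn_on {0..<n} (\<lambda>i j. A $$ (i, j))"
  shows "A \<in> spn_mats n"
proof -
  have carr: "A \<in> carrier_mat n n" and symA: "symmetric_on {0..<n} (\<lambda>i j. A $$ (i, j))"
    using A by (auto simp: sym_mats_iff)
  obtain p where p: "symmetric_on {0..<n} p" "\<And>x. 0 \<le> quad_form {0..<n} p x"
    "\<And>i j. i < n \<Longrightarrow> j < n \<Longrightarrow> p i j \<le> A $$ (i, j)"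
    using spn unfolding spn_on_def by auto
  define P where "P = mat n n (\<lambda>(i, j). p i j)"
  define N where "N = mat n n (\<lambda>(i, j). A $$ (i, j) - p i j)"
  have "0 \<le> x \<bullet> (P *\<^sub>v x)" if "x \<in> carrier_vec n" for x
  proof -
    have "x \<bullet> (P *\<^sub>v x) = quad_form {0..<n} (\<lambda>i j. P $$ (i, j)) (\<lambda>i. x $ i)"
      using that by (intro scalar_prod_mult_mat_vec_eq_quad_form) (auto simp: P_def)
    also have "\<dots> = quad_form {0..<n} p (\<lambda>i. x $ i)"
      by (rule quad_form_cong) (auto simp: P_def)
    finally show ?thesis using p(2) by simp
  qed
  then have "P \<in> psd_mats n"
    using p(1) by (auto simp: psd_mats_def sym_mats_iff symmetric_on_def P_def)
  moreover have "N \<in> nonneg_sym_mats n"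
    using p(1,3) symA
    by (auto simp: nonneg_sym_mats_def sym_mats_iff symmetric_on_def less_eq_mat_def N_def)
  moreover have "A = P + N"
    using carr by (intro eq_matI) (auto simp: P_def N_def)
  ultimately show ?thesis
    unfolding spn_mats_def by blast
qed

lemma spn_mats_subset_copositive_mats: "spn_mats n \<subseteq> copositive_mats n"
proof
  fix A assume "A \<in> spn_mats n"
  then obtain P N where A: "A = P + N" and P: "P \<in> psd_mats n" and N: "N \<in> nonneg_sym_mats n"
    by (auto simp: spn_mats_def)
  have Pc: "P \<in> carrier_mat n n" and Nc: "N \<in> carrier_mat n n"
    using P N by (auto simp: psd_mats_def nonneg_sym_mats_def sym_mats_def)
  have "A \<in> sym_mats n"
    using P N by (auto simp: psd_mats_def nonneg_sym_mats_def sym_mats_iff symmetric_on_def A)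
  moreover have "0 \<le> x \<bullet> (A *\<^sub>v x)" if x: "x \<in> carrier_vec n" and x0: "0\<^sub>v n \<le> x" for x
  proof -
    have "0 \<le> x $ i" if "i < n" for i
      using x x0 that by (auto simp: less_eq_vec_def)
    moreover have "0 \<le> N $$ (i, j)" if "i < n" "j < n" for i j
      using N Nc that by (auto simp: nonneg_sym_mats_def less_eq_mat_def)
    ultimately have "0 \<le> x \<bullet> (N *\<^sub>v x)"
      unfolding scalar_prod_mult_mat_vec_eq_quad_form[OF Nc x] quad_form_def
      by (intro sum_nonneg) auto
    moreover have "0 \<le> x \<bullet> (P *\<^sub>v x)"
      using P x by (auto simp: psd_mats_def)
    moreover have "x \<bullet> (A *\<^sub>v x) = x \<bullet> (P *\<^sub>v x) + x \<bullet> (N *\<^sub>v x)"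
      unfolding A using Pc Nc x
      by (subst add_mult_distrib_mat_vec[OF Pc Nc x]) (simp add: scalar_prod_add_distrib[of _ n])
    ultimately show ?thesis by simp
  qed
  ultimately show "A \<in> copositive_mats n"
    by (auto simp: copositive_mats_def)
qed

lemma R_mats_monotone_pattern:
  assumes "M \<in> R_mats n"
  shows "monotone_pattern (pos_idx M) 0 n (\<lambda>i j. M $$ (i, j))"
proof -
  have M: "M \<in> carrier_mat n n" "cond_I n M" "cond_II n M"
    using assms by (auto simp: R_mats_def sym_mats_def)
  have "pos_idx M \<le> i" if "i < j" "j < n" "0 < M $$ (i, j)" for i j
  proof -
    have i: "i \<in> pos_rows M"
      using that M(1) by (auto simp: pos_rows_def)
    moreover have "finite (pos_rows M)"
      by (simp add: pos_rows_def)
    ultimately show ?thesis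
      by (auto simp: pos_idx_def)
  qed
  then show ?thesis
    using M(2,3) by (auto simp: monotone_pattern_def cond_I_def cond_II_def)
qed

theorem theorem3p9:
  fixes n :: nat
  assumes "n \<ge> 1"
  shows "R_mats n \<inter> copositive_mats n = R_mats n \<inter> spn_mats n"
proof -
  have "M \<in> spn_mats n" if R: "M \<in> R_mats n" and cop: "M \<in> copositive_mats n" for M
  proof -
    have sym: "M \<in> sym_mats n"
      using R by (simp add: R_mats_def)
    then have "symmetric_on {0..<n} (\<lambda>i j. M $$ (i, j))"
      by (simp add: sym_mats_iff)
    with copositive_mats_copositive_on[OF cop]
    have "spn_on {0..<n} (\<lambda>i j. M $$ (i, j))"
      using R_mats_monotone_pattern[OF R] by (rule copositive_monotone_pattern_spn)
    with sym show ?thesis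
      by (rule spn_on_spn_mats)
  qed
  then show ?thesis
    using spn_mats_subset_copositive_mats by blast
qed

end
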